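(* Let $G$ be a (finite, loopless) multigraph with $\chi_{DP}(G) \leq 3$. Suppose $|V(G)| = n$, $|E(G)| = l$, and $2n \geq l$. Then $P_{DP}(G,3) \geq 3^{\,n - l/2}$.
   Context: All graphs are nonempty, finite, undirected, loopless multigraphs (parallel edges allowed). For vertices $u,v$ of $G$, $E_G(u,v)$ is the set of edges with endpoints $u$ and $v$ and $e_G(u,v)=|E_G(u,v)|$. A cover of $G$ is a triple $\mathcal{H}=(L,H,M)$ where $L$ assigns to each $v\in V(G)$ a set $L(v)=\{(v,a): a\in A_v\}$ with $A_v$ a nonempty finite set, $H$ is a multigraph with vertex set $\bigcup_{v} L(v)$, and $M$ assigns to each edge $e\in E(G)$ with endpoints $u,v$ a matching $M(e)$ each of whose edges has one endpoint in $L(u)$ and the other in $L(v)$, such that: (1) $H[L(u)]$ is a complete graph for every $u$; (2) $M(e_1)\cap M(e_2)=\emptyset$ for distinct edges $e_1,e_2$; (3) for distinct $u,v$, the set of edges of $H$ between $L(u)$ and $L(v)$ is $\bigcup_{e\in E_G(u,v)} M(e)$. An $\mathcal{H}$-coloring of $G$ is an independent set in $H$ of size $|V(G)|$. The cover is $m$-fold if $|L(u)|=m$ for all $u$, and a full $m$-fold cover if moreover $H$ has exactly $e_G(u,v)\,m$ edges between $L(u)$ and $L(v)$ for all distinct $u,v$. The DP-chromatic number $\chi_{DP}(G)$ is the least $k$ such that $G$ has an $\mathcal{H}$-coloring for every $k$-fold cover $\mathcal{H}$. $P_{DP}(G,m)$ (the DP color function) is the minimum, over all full $m$-fold covers $\mathcal{H}$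 of $G$, of the number of $\mathcal{H}$-colorings of $G$. *)

theory Defs
  imports Complex_Main
begin

record ('v, 'e) multigraph =
  verts :: "'v set"
  edges :: "'e set"
  ends  :: "'e \<Rightarrow> 'v set"

definition multigraph :: "('v, 'e) multigraph \<Rightarrow> bool" where
  "multigraph G \<longleftrightarrow> finite (verts G) \<and> verts G \<noteq> {} \<and> finite (edges G) \<and>
     (\<forall>e\<in>edges G. \<exists>u\<in>verts G. \<exists>v\<in>verts G. u \<noteq> v \<and> ends G e = {u, v})"

definition edges_between :: "('v, 'e) multigraph \<Rightarrow> 'v \<Rightarrow> 'v \<Rightarrow> 'e set" where
  "edges_between G u v = {e \<in> edges G. ends G e = {u, v}}"

definition edges_across :: "('v, 'e) multigraph \<Rightarrow> 'v set \<Rightarrow> 'v set \<Rightarrow> 'e set" where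
  "edges_across G X Y = {e \<in> edges G. \<exists>x\<in>X. \<exists>y\<in>Y. ends G e = {x, y}}"

definition independent_set :: "('v, 'e) multigraph \<Rightarrow> 'v set \<Rightarrow> bool" where
  "independent_set G I \<longleftrightarrow> I \<subseteq> verts G \<and> (\<forall>e\<in>edges G. \<not> ends G e \<subseteq> I)"

definition matching :: "('v, 'e) multigraph \<Rightarrow> 'e set \<Rightarrow> bool" where
  "matching G F \<longleftrightarrow> F \<subseteq> edges G \<and>
     (\<forall>f\<in>F. \<forall>g\<in>F. f \<noteq> g \<longrightarrow> ends G f \<inter> ends G g = {})"

text \<open>A complete graph is simple: distinct vertices are joined by exactly one edge, also when
  the ambient graph is a multigraph.\<close>

definition induces_complete :: "('v, 'e) multigraph \<Rightarrow> 'v set \<Rightarrow> bool" where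
  "induces_complete G X \<longleftrightarrow>
     (\<forall>x\<in>X. \<forall>y\<in>X. x \<noteq> y \<longrightarrow> (\<exists>!e. e \<in> edges_between G x y))"

definition cover :: "('v, 'e) multigraph \<Rightarrow> ('v \<Rightarrow> ('v \<times> 'c) set) \<Rightarrow>
    ('v \<times> 'c, 'f) multigraph \<Rightarrow> ('e \<Rightarrow> 'f set) \<Rightarrow> bool" where
  "cover G L H M \<longleftrightarrow>
     multigraph H \<and>
     (\<forall>v\<in>verts G. \<exists>A. finite A \<and> A \<noteq> {} \<and> L v = {v} \<times> A) \<and>
     verts H = (\<Union>v\<in>verts G. L v) \<and>
     (\<forall>e\<in>edges G. matching H (M e)) \<and>
     (\<forall>e\<in>edges G. \<forall>u v. ends G e = {u, v} \<longrightarrow> M e \<subseteq> edges_across H (L u) (L v)) \<and>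
     (\<forall>u\<in>verts G. induces_complete H (L u)) \<and>
     (\<forall>e1\<in>edges G. \<forall>e2\<in>edges G. e1 \<noteq> e2 \<longrightarrow> M e1 \<inter> M e2 = {}) \<and>
     (\<forall>u\<in>verts G. \<forall>v\<in>verts G. u \<noteq> v \<longrightarrow>
        edges_across H (L u) (L v) = (\<Union>e\<in>edges_between G u v. M e))"

definition fold_cover :: "nat \<Rightarrow> ('v, 'e) multigraph \<Rightarrow> ('v \<Rightarrow> ('v \<times> 'c) set) \<Rightarrow>
    ('v \<times> 'c, 'f) multigraph \<Rightarrow> ('e \<Rightarrow> 'f set) \<Rightarrow> bool" where
  "fold_cover m G L H M \<longleftrightarrow> cover G L H M \<and> (\<forall>u\<in>verts G. card (L u) = m)"

definition full_fold_cover :: "nat \<Rightarrow> ('v, 'e) multigraph \<Rightarrow> ('v \<Rightarrow> ('v \<times> 'c) set) \<Rightarrow>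
    ('v \<times> 'c, 'f) multigraph \<Rightarrow> ('e \<Rightarrow> 'f set) \<Rightarrow> bool" where
  "full_fold_cover m G L H M \<longleftrightarrow> fold_cover m G L H M \<and>
     (\<forall>u\<in>verts G. \<forall>v\<in>verts G. u \<noteq> v \<longrightarrow>
        card (edges_across H (L u) (L v)) = card (edges_between G u v) * m)"

definition colorings :: "('v, 'e) multigraph \<Rightarrow> ('v \<times> 'c, 'f) multigraph \<Rightarrow> ('v \<times> 'c) set set" where
  "colorings G H = {I. independent_set H I \<and> card I = card (verts G)}"

text \<open>Covers are finite objects, so in the next two definitions the labels and the edges of
  the cover graph are drawn from \<^typ>\<open>nat\<close>; \<open>cover_nat\<close> below shows that every cover, over
  arbitrary types, has an isomorphic copy of this form.
  The restriction to positive \<open>k\<close> matters: since lists of a cover are nonempty, there is no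
  \<open>0\<close>-fold cover, and \<open>k = 0\<close> would satisfy the remaining condition vacuously.
  For a multigraph the least element exists in both cases (every \<open>k\<close> above the maximum degree
  qualifies by a greedy choice; full \<open>m\<close>-fold covers exist whenever \<open>m > 0\<close>).\<close>

definition dp_chromatic_number :: "('v, 'e) multigraph \<Rightarrow> nat" where
  "dp_chromatic_number G = (LEAST k. 0 < k \<and>
     (\<forall>(L :: 'v \<Rightarrow> ('v \<times> nat) set) (H :: ('v \<times> nat, nat) multigraph) M.
        fold_cover k G L H M \<longrightarrow> colorings G H \<noteq> {}))"

definition dp_color_function :: "('v, 'e) multigraph \<Rightarrow> nat \<Rightarrow> nat" where
  "dp_color_function G m = (LEAST N.
     \<exists>(L :: 'v \<Rightarrow> ('v \<times> nat) set) (H :: ('v \<times> nat, nat) multigraph) M.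
        full_fold_cover m G L H M \<and> card (colorings G H) = N)"

lemma cover_nat:
  fixes L :: "'v \<Rightarrow> ('v \<times> 'c) set" and H :: "('v \<times> 'c, 'f) multigraph"
  assumes G: "multigraph G" and C: "cover G L H M"
  obtains g :: "'c \<Rightarrow> nat" and h :: "'f \<Rightarrow> nat"
    and L' :: "'v \<Rightarrow> ('v \<times> nat) set" and H' :: "('v \<times> nat, nat) multigraph" and M'
  where "inj_on (map_prod id g) (verts H)" "inj_on h (edges H)"
    "verts H' = map_prod id g ` verts H" "edges H' = h ` edges H"
    "\<And>f. f \<in> edges H \<Longrightarrow> ends H' (h f) = map_prod id g ` ends H f"
    "\<And>v. L' v = map_prod id g ` L v" "\<And>e. M' e = h ` M e"
    "cover G L' H' M'"
proof -
  have H: "multigraph H" and VH: "verts H = (\<Union>v\<in>verts G. L v)"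
    using C by (auto simp: cover_def)
  have fin: "finite (verts H)" "finite (edges H)"
    using H by (auto simp: multigraph_def)
  obtain g :: "'c \<Rightarrow> nat" where g: "inj_on g (snd ` verts H)"
    using finite_imp_inj_to_nat_seg[of "snd ` verts H"] fin by blast
  obtain h :: "'f \<Rightarrow> nat" where h: "inj_on h (edges H)"
    using finite_imp_inj_to_nat_seg[of "edges H"] fin by blast
  define p where "p = (map_prod id g :: 'v \<times> 'c \<Rightarrow> _)"
  have p: "inj_on p (verts H)"
    using g by (force simp: p_def inj_on_def)
  define H' where "H' = \<lparr>verts = p ` verts H, edges = h ` edges H,
     ends = (\<lambda>k. p ` ends H (inv_into (edges H) h k))\<rparr>"
  have e': "ends H' (h f) = p ` ends H f" if "f \<in> edges H" for f
    using that h by (simp add: H'_def)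
  have v': "verts H' = p ` verts H" and E': "edges H' = h ` edges H"
    by (simp_all add: H'_def)
  have sub: "ends H f \<subseteq> verts H" if "f \<in> edges H" for f
    using H that by (fastforce simp: multigraph_def)
  have iff: "ends H' (h f) = {p x, p y} \<longleftrightarrow> ends H f = {x, y}"
    if "f \<in> edges H" "x \<in> verts H" "y \<in> verts H" for f x y
    using inj_on_image_eq_iff[OF p, of "ends H f" "{x, y}"] that sub[of f] e'[of f] by auto
  have across: "edges_across H' (p ` X) (p ` Y) = h ` edges_across H X Y"
    if XY: "X \<subseteq> verts H" "Y \<subseteq> verts H" for X Y
  proof -
    have "f \<in> edges_across H X Y \<longleftrightarrow> h f \<in> edges_across H' (p ` X) (p ` Y)"
      if f: "f \<in> edges H" for f
    proof -
      have "(\<exists>x\<in>X. \<exists>y\<in>Y. ends H f = {x, y}) \<longleftrightarrow> (\<exists>x\<in>X. \<exists>y\<in>Y. ends H' (h f) = {p x, p y})"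
        by (intro bex_cong refl) (use iff f XY in blast)
      then show ?thesis using f by (simp add: edges_across_def E')
    qed
    moreover have "edges_across H' (p ` X) (p ` Y) \<subseteq> h ` edges H" "edges_across H X Y \<subseteq> edges H"
      by (auto simp: edges_across_def E')
    ultimately show ?thesis by blast
  qed
  have between: "edges_between H' (p x) (p y) = h ` edges_between H x y"
    if "x \<in> verts H" "y \<in> verts H" for x y
    unfolding edges_between_def E' using iff[OF _ that] by blast
  have Lsub: "L v \<subseteq> verts H" if "v \<in> verts G" for v
    using that VH by auto
  have Msub: "M e \<subseteq> edges H" if "e \<in> edges G" for e
    using C that by (auto simp: cover_def matching_def)
  have "cover G (\<lambda>v. p ` L v) H' (\<lambda>e. h ` M e)"
    unfolding cover_def
  proof (intro conjI)
    have "\<exists>u\<in>verts H'. \<exists>v\<in>verts H'. u \<noteq> v \<and> ends H' e = {u, v}" if e: "e \<in> edges H'" for e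
    proof -
      obtain f where f: "f \<in> edges H" "e = h f" using e E' by auto
      then obtain u v where "u \<in> verts H" "v \<in> verts H" "u \<noteq> v" "ends H f = {u, v}"
        using H unfolding multigraph_def by meson
      then show ?thesis
        by (intro bexI[of _ "p u"] bexI[of _ "p v"])
          (use f e' v' p in \<open>auto dest: inj_onD\<close>)
    qed
    then show "multigraph H'"
      using H unfolding multigraph_def by (metis E' v' finite_imageI image_is_empty)
    show "\<forall>v\<in>verts G. \<exists>A. finite A \<and> A \<noteq> {} \<and> p ` L v = {v} \<times> A"
    proof
      fix v assume "v \<in> verts G"
      then obtain A where A: "finite A" "A \<noteq> {}" "L v = {v} \<times> A"
        using C unfolding cover_def by meson
      then have "p ` L v = {v} \<times> g ` A" by (force simp: p_def)
      then show "\<exists>A. finite A \<and> A \<noteq> {} \<and> p ` L v = {v} \<times> A"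
        using A by blast
    qed
    show "verts H' = (\<Union>v\<in>verts G. p ` L v)"
      using VH v' by auto
    show "\<forall>e\<in>edges G. matching H' (h ` M e)"
    proof
      fix e assume e: "e \<in> edges G"
      then have m: "matching H (M e)" using C by (auto simp: cover_def)
      have "ends H' (h a) \<inter> ends H' (h b) = {}" if "a \<in> M e" "b \<in> M e" "h a \<noteq> h b" for a b
      proof -
        have ab: "a \<in> edges H" "b \<in> edges H" using that Msub[OF e] by auto
        have "ends H a \<inter> ends H b = {}"
          using m that unfolding matching_def by metis
        then show ?thesis
          using inj_on_image_Int[OF p sub[OF ab(1)] sub[OF ab(2)]]
          by (simp add: e'[OF ab(1)] e'[OF ab(2)])
      qed
      then show "matching H' (h ` M e)"
        using Msub[OF e] unfolding matching_def E' by auto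
    qed
    show "\<forall>e\<in>edges G. \<forall>u v. ends G e = {u, v} \<longrightarrow> h ` M e \<subseteq> edges_across H' (p ` L u) (p ` L v)"
    proof (intro ballI allI impI)
      fix e u v assume e: "e \<in> edges G" "ends G e = {u, v}"
      then have uv: "u \<in> verts G" "v \<in> verts G"
        using G unfolding multigraph_def by fastforce+
      have "M e \<subseteq> edges_across H (L u) (L v)"
        using C e unfolding cover_def by meson
      then show "h ` M e \<subseteq> edges_across H' (p ` L u) (p ` L v)"
        unfolding across[OF Lsub[OF uv(1)] Lsub[OF uv(2)]] by (rule image_mono)
    qed
    show "\<forall>u\<in>verts G. induces_complete H' (p ` L u)"
    proof
      fix u assume u: "u \<in> verts G"
      then have c: "induces_complete H (L u)" using C by (auto simp: cover_def)
      have "\<exists>!e. e \<in> edges_between H' (p x) (p y)" if "x \<in> L u" "y \<in> L u" "p x \<noteq> p y" for x y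
      proof -
        have xy: "x \<in> verts H" "y \<in> verts H" using that Lsub[OF u] by auto
        have "\<exists>!e. e \<in> edges_between H x y"
          using c that unfolding induces_complete_def by metis
        then show ?thesis unfolding between[OF xy] by blast
      qed
      then show "induces_complete H' (p ` L u)"
        unfolding induces_complete_def by blast
    qed
    show "\<forall>e1\<in>edges G. \<forall>e2\<in>edges G. e1 \<noteq> e2 \<longrightarrow> h ` M e1 \<inter> h ` M e2 = {}"
    proof (intro ballI impI)
      fix e1 e2 assume e: "e1 \<in> edges G" "e2 \<in> edges G" "e1 \<noteq> e2"
      then have "M e1 \<inter> M e2 = {}" using C unfolding cover_def by meson
      then show "h ` M e1 \<inter> h ` M e2 = {}"
        using inj_on_image_Int[OF h Msub[OF e(1)] Msub[OF e(2)]] by simp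
    qed
    show "\<forall>u\<in>verts G. \<forall>v\<in>verts G. u \<noteq> v \<longrightarrow>
        edges_across H' (p ` L u) (p ` L v) = (\<Union>e\<in>edges_between G u v. h ` M e)"
    proof (intro ballI impI)
      fix u v assume uv: "u \<in> verts G" "v \<in> verts G" "u \<noteq> v"
      then have "edges_across H (L u) (L v) = (\<Union>e\<in>edges_between G u v. M e)"
        using C unfolding cover_def by meson
      then show "edges_across H' (p ` L u) (p ` L v) = (\<Union>e\<in>edges_between G u v. h ` M e)"
        unfolding across[OF Lsub[OF uv(1)] Lsub[OF uv(2)]] by auto
    qed
  qed
  then show thesis
    using that[of g h H' "\<lambda>v. p ` L v" "\<lambda>e. h ` M e"] p h v' E' e' unfolding p_def by blast
qed

end

theory Submission
  imports Defs "HOL-Library.Function_Algebras" "HOL-Library.Numeral_Type"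
begin

text \<open>
  A permutation of a three-element list is an affine map of \<open>\<int>/3\<close>. Labelling every list of a full
  \<open>3\<close>-fold cover by \<open>\<int>/3\<close> therefore turns each matching into the zero set of an affine form, and
  the colorings into the points of the grid \<open>(\<int>/3)\<^sup>n\<close> where a product of \<open>l\<close> affine forms does not
  vanish. The bound on the DP-chromatic number provides one such point, and the Alon--Fueredi
  argument, which uses the degree only through iterated finite differences, provides at least
  \<open>3\<^bsup>n - l/2\<^esup>\<close> of them.
\<close>

text \<open>The exponent loses one half per degree because of an extreme trade. Cut the grid along
  one coordinate: confining the nonzeros to one of the three slices divides their number by 3 and
  uses up two degrees. Squaring removes the half, so the count N of nonzeros in degree d is handled
  as 9^n \<le> 3^d * N^2 over the natural numbers, and the root is taken only at the end. Finite
  differences make the degree drop easy to see. Subtracting a translate that vanishes on the grid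
  leaves the values on the grid alone, yet lowers the degree as a function on the whole group;
  nothing has to be divided out and no reduced form of a polynomial is needed. On the graph side,
  both invariants are given by \<open>LEAST\<close>, which says something only once a witness
  exists; hence a greedy coloring and an explicit full cover. Moreover the DP-chromatic number may
  lie below 3, so colorability has to be carried from smaller lists up to lists of size 3.\<close>

subsection \<open>Nonzeros of functions of bounded degree over \<open>\<int>/3\<close>\<close>

text \<open>Degree less than \<open>d\<close>, measured by finite differences instead of by a polynomial representation.\<close>

primrec deg_less :: "nat \<Rightarrow> ('a::ab_group_add \<Rightarrow> 'b::comm_ring_1) \<Rightarrow> bool" where
  "deg_less 0 f \<longleftrightarrow> (\<forall>x. f x = 0)"
| "deg_less (Suc d) f \<longleftrightarrow> (\<forall>h. deg_less d (\<lambda>x. f (x + h) - f x))"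

lemma deg_less_add: "deg_less d f \<Longrightarrow> deg_less d g \<Longrightarrow> deg_less d (\<lambda>x. f x + g x)"
proof (induction d arbitrary: f g)
  case (Suc d)
  have "deg_less d (\<lambda>x. (f (x + h) - f x) + (g (x + h) - g x))" for h
    using Suc by simp
  then show ?case by (simp add: algebra_simps)
qed simp

lemma deg_less_mult_const: "deg_less d f \<Longrightarrow> deg_less d (\<lambda>x. f x * c)"
proof (induction d arbitrary: f)
  case (Suc d)
  have "deg_less d (\<lambda>x. (f (x + h) - f x) * c)" for h
    using Suc by simp
  then show ?case by (simp add: algebra_simps)
qed simp

lemma deg_less_shift: "deg_less d f \<Longrightarrow> deg_less d (\<lambda>x. f (x + k))"
proof (induction d arbitrary: f)
  case (Suc d)
  have "deg_less d (\<lambda>x. f (x + k + h) - f (x + k))" for h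
    using Suc.IH[of "\<lambda>x. f (x + h) - f x"] Suc.prems by simp
  then show ?case by (simp add: ac_simps)
qed simp

text \<open>Discrete Leibniz rule: the difference of the product by h is (f (x + h) - f x) * a (x +
  h) + f x * c h. The first summand falls to the induction hypothesis, the second is a constant
  multiple of f.\<close>

lemma deg_less_mult_affine:
  assumes "deg_less d f" and "\<And>x h. a (x + h) = a x + c h"
  shows "deg_less (Suc d) (\<lambda>x. f x * a x)"
  using assms
proof (induction d arbitrary: f a)
  case (Suc d)
  have "deg_less (Suc d) (\<lambda>x. f (x + h) * a (x + h) - f x * a x)" for h
  proof -
    \<comment> \<open>Translating an affine form keeps its increments \<open>c\<close>, so the
      induction hypothesis applies to the translate of \<open>a\<close>.\<close>
    have 1: "a (x + k + h) = a (x + h) + c k" for x k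
      using Suc.prems(2)[of "x + h" k] by (simp add: ac_simps)
    have "deg_less (Suc d) (\<lambda>x. (f (x + h) - f x) * a (x + h))"
      by (rule Suc.IH[of "\<lambda>x. f (x + h) - f x" "\<lambda>x. a (x + h)"]) (use Suc.prems 1 in auto)
    moreover have "deg_less (Suc d) (\<lambda>x. f x * c h)"
      using Suc.prems by (intro deg_less_mult_const)
    ultimately have "deg_less (Suc d) (\<lambda>x. (f (x + h) - f x) * a (x + h) + f x * c h)"
      by (rule deg_less_add)
    moreover have "(\<lambda>x. (f (x + h) - f x) * a (x + h) + f x * c h) =
        (\<lambda>x. f (x + h) * a (x + h) - f x * a x)"
      by (simp add: Suc.prems(2) algebra_simps)
    ultimately show ?thesis by (simp only:)
  qed
  then show ?case by (subst deg_less.simps) blast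
qed simp

text \<open>The successor is due to strictness: the empty product 1 already needs
  \<open>deg_less 1\<close>, and each factor adds one.\<close>

lemma deg_less_prod_affine:
  assumes "finite E" and "\<And>e x h. e \<in> E \<Longrightarrow> a e (x + h) = a e x + c e h"
  shows "deg_less (Suc (card E)) (\<lambda>x. \<Prod>e\<in>E. a e x)"
  using assms
proof (induction E rule: finite_induct)
  case (insert e E)
  have "deg_less (Suc (card E)) (\<lambda>x. \<Prod>e\<in>E. a e x)"
    using insert by simp
  from deg_less_mult_affine[OF this, of "a e" "c e"] insert show ?case
    by (simp add: mult.commute del: deg_less.simps)
qed simp

text \<open>The grid with coordinates V sits inside one group of functions on the whole type, so
  that translations and degree keep their meaning while V grows in an induction.\<close>

definition supp :: "'v set \<Rightarrow> ('v \<Rightarrow> 'b::zero) set" where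
  "supp V = {x. \<forall>v. v \<notin> V \<longrightarrow> x v = 0}"

definition nonzeros :: "'v set \<Rightarrow> (('v \<Rightarrow> 'b::zero) \<Rightarrow> 'c::zero) \<Rightarrow> ('v \<Rightarrow> 'b) set" where
  "nonzeros V f = {x \<in> supp V. f x \<noteq> 0}"

lemma finite_supp:
  assumes "finite V" shows "finite (supp V :: ('v \<Rightarrow> 'b::{zero,finite}) set)"
proof -
  have "finite {x :: 'v \<Rightarrow> 'b. \<forall>v. (v \<in> V \<longrightarrow> x v \<in> UNIV) \<and> (v \<notin> V \<longrightarrow> x v = 0)}"
    using assms by (intro finite_set_of_finite_funs) auto
  then show ?thesis by (simp add: supp_def)
qed

definition unit_at :: "'v \<Rightarrow> 'b::zero \<Rightarrow> 'v \<Rightarrow> 'b" where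
  "unit_at v a = (\<lambda>w. if w = v then a else 0)"

text \<open>The slice with v-coordinate a is translated back to the smaller grid; the inverse reads
  off that coordinate and subtracts it.\<close>

lemma card_nonzeros_insert:
  fixes f :: "('v \<Rightarrow> 'b::{ab_group_add,finite}) \<Rightarrow> 'c::zero"
  assumes "finite V" "v \<notin> V"
  shows "card (nonzeros (insert v V) f) = (\<Sum>a\<in>UNIV. card (nonzeros V (\<lambda>x. f (x + unit_at v a))))"
proof -
  let ?g = "\<lambda>(a, x). x + unit_at v a"
  let ?S = "SIGMA a:UNIV. nonzeros V (\<lambda>x. f (x + unit_at v a))"
  have fin: "finite (nonzeros V (\<lambda>x. f (x + unit_at v a)))" for a
    using finite_supp[OF assms(1)] by (auto simp: nonzeros_def)
  have "bij_betw ?g ?S (nonzeros (insert v V) f)"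
    by (rule bij_betw_byWitness[where f' = "\<lambda>y. (y v, y - unit_at v (y v))"])
      (use assms(2) in \<open>auto simp: nonzeros_def supp_def unit_at_def fun_eq_iff\<close>)
  then have "card (nonzeros (insert v V) f) = card ?S"
    by (simp add: bij_betw_same_card)
  also have "\<dots> = (\<Sum>a\<in>UNIV. card (nonzeros V (\<lambda>x. f (x + unit_at v a))))"
    using fin by (subst card_SigmaI) auto
  finally show ?thesis .
qed

lemma unit_at_diff:
  "unit_at v (a - b) = unit_at v a - unit_at v (b :: 'b::ab_group_add)"
  by (auto simp: unit_at_def fun_eq_iff)

lemma UNIV_3: "(UNIV :: 3 set) = {a, a + 1, a + 2}"
proof -
  have "card {a, a + 1, a + 2} = 3"
    by simp
  then have "card {a, a + 1, a + 2} = CARD(3)" by simp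
  then show ?thesis using card_subset_eq[of UNIV "{a, a+1, a+2}"] by simp
qed

text \<open>Squared form of the bound 3^(card V - d/2). A new coordinate must gain a factor 9 on the
  right, paid for partly by the number of nonzero slices and partly by the degree lost when other
  slices vanish.\<close>

lemma alon_furedi_3:
  fixes f :: "('v \<Rightarrow> 3) \<Rightarrow> 'c::comm_ring_1"
  assumes "finite V" "deg_less (Suc d) f" "nonzeros V f \<noteq> {}"
  shows "9 ^ card V \<le> 3 ^ d * (card (nonzeros V f))\<^sup>2"
  using assms
proof (induction V arbitrary: f d rule: finite_induct)
  case empty
  have "supp {} = {0 :: 'v \<Rightarrow> 3}"
    by (auto simp: supp_def fun_eq_iff)
  with empty have "nonzeros {} f = {0}"
    by (auto simp: nonzeros_def)
  then show ?case by simp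
next
  case (insert v V)
  define F where "F a x = f (x + unit_at v a)" for a x
  define N where "N a = card (nonzeros V (F a))" for a
  define T where "T = {a. nonzeros V (F a) \<noteq> {}}"
  have N: "card (nonzeros (insert v V) f) = (\<Sum>a\<in>UNIV. N a)"
    unfolding N_def F_def using insert by (intro card_nonzeros_insert)
  have fin: "finite (nonzeros V (F a))" for a
    using finite_supp[OF insert(1)] by (auto simp: nonzeros_def)
  have N0: "N a = 0 \<longleftrightarrow> a \<notin> T" for a
    using fin by (simp add: N_def T_def)
  have vanish: "F b x = 0" if "b \<notin> T" "x \<in> supp V" for b x
    using that by (auto simp: T_def nonzeros_def)
  have nz: "card (nonzeros (insert v V) f) \<noteq> 0"
    using insert.prems finite_supp[of "insert v V"] insert(1)
    by (subst card_0_eq) (auto simp: nonzeros_def)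
  have "T \<noteq> {}"
    using nz N N0 by (metis empty_iff sum.neutral)
  \<comment> \<open>Agreement on \<open>supp V\<close> is enough: the slice \<open>F a\<close> need
    not have small degree on the whole group, but a suitable \<open>g\<close> with the same values
    on the grid does.\<close>
  have slice: "9 ^ card V \<le> 3 ^ d' * (N a)\<^sup>2"
    if "a \<in> T" "deg_less (Suc d') g" "\<And>x. x \<in> supp V \<Longrightarrow> g x = F a x" for a d' g
  proof -
    have "nonzeros V g = nonzeros V (F a)" using that by (auto simp: nonzeros_def)
    then show ?thesis using insert.IH[of d' g] that by (simp add: N_def T_def)
  qed
  \<comment> \<open>The degree cannot run out: \<open>deg_less 0\<close> means identically zero,
    which a nonzero slice excludes.\<close>
  have pos: "\<exists>d'. d = Suc d'" if "a \<in> T" "deg_less d g" "\<And>x. x \<in> supp V \<Longrightarrow> g x = F a x" for a d g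
    using that by (cases d) (auto simp: T_def nonzeros_def)
  have "finite T" by (rule finite)
  \<comment> \<open>The smallest nonzero slice bounds all the others from below, so the total is at
    least \<open>card T * N a\<close>.\<close>
  define a where "a = arg_min_on N T"
  have a: "a \<in> T" "\<And>b. b \<in> T \<Longrightarrow> N a \<le> N b"
    unfolding a_def using arg_min_if_finite(1)[OF \<open>finite T\<close> \<open>T \<noteq> {}\<close>]
      arg_min_least[OF \<open>finite T\<close> \<open>T \<noteq> {}\<close>] by auto
  have "card T * N a \<le> (\<Sum>b\<in>T. N b)"
    using sum_bounded_below[of T "N a" N] a by simp
  also have "\<dots> = (\<Sum>b\<in>UNIV. N b)"
    using N0 by (intro sum.mono_neutral_left) auto
  finally have le: "card T * N a \<le> card (nonzeros (insert v V) f)"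
    by (simp add: N)
  have "card T \<le> card (UNIV :: 3 set)" by (rule card_mono) auto
  moreover have "card T > 0" using \<open>T \<noteq> {}\<close> by (simp add: card_gt_0_iff)
  ultimately consider "card T = 3" | "card T = 2" | "card T = 1"
    by fastforce
  \<comment> \<open>With k = \<open>card T\<close>, the slice at \<open>a\<close> has 3 - k degrees
    less, and k^2 * 3^(3-k) is 9, 12, 9 for k = 3, 2, 1: always at least the required 9.\<close>
  then have "9 * 9 ^ card V \<le> 3 ^ d * (card T * N a)\<^sup>2"
  proof cases
    case 1
    have "deg_less (Suc d) (F a)" unfolding F_def
      using insert.prems by (intro deg_less_shift)
    from slice[OF a(1) this] 1 show ?thesis by (simp add: power_mult_distrib)
  next
    case 2
    \<comment> \<open>With a vanishing slice at \<open>b\<close>, the slice at \<open>a\<close> is a first difference of \<open>f\<close>.\<close>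
    then have "T \<noteq> UNIV" by auto
    then obtain b where b: "b \<notin> T" by auto
    define g where "g x = F a x - F b x" for x
    have "g = (\<lambda>x. f (x + unit_at v b + unit_at v (a - b)) - f (x + unit_at v b))"
      by (simp add: g_def F_def unit_at_diff fun_eq_iff)
    moreover have "deg_less d (\<lambda>x. f (x + unit_at v (a - b)) - f x)"
      using insert.prems by simp
    from deg_less_shift[OF this]
    have "deg_less d (\<lambda>x. f (x + unit_at v b + unit_at v (a - b)) - f (x + unit_at v b))" .
    ultimately have g: "deg_less d g" by simp
    have gF: "g x = F a x" if "x \<in> supp V" for x
      using vanish[OF b that] by (simp add: g_def)
    obtain d' where d': "d = Suc d'" using pos[OF a(1) g gF] by auto
    then show ?thesis using slice[OF a(1) _ gF, of d'] g 2
      by (simp add: power_mult_distrib)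
  next
    case 3
    \<comment> \<open>With two vanishing slices, the remaining one is a second difference of \<open>f\<close>.\<close>
    then have T: "T = {a}" using a(1) by (auto simp: card_1_singleton_iff)
    define D where "D x = f (x + unit_at v 1) - f x" for x
    \<comment> \<open>This expands to F (a + 2) - 2 F (a + 1) + F a. Starting at \<open>a\<close>
      puts the two vanishing slices at a + 1 and a + 2 and leaves \<open>F a\<close> with
      coefficient 1.\<close>
    define g where "g x = D (x + unit_at v a + unit_at v 1) - D (x + unit_at v a)" for x
    have D: "deg_less d D" using insert.prems by (simp add: D_def[abs_def])
    have gF: "g x = F a x" if "x \<in> supp V" for x
    proof -
      have "unit_at v a + unit_at v 1 = unit_at v (a + 1)"
        "unit_at v a + unit_at v 1 + unit_at v 1 = unit_at v (a + 2)"
        by (auto simp: unit_at_def fun_eq_iff)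
      then have "g x = F (a + 2) x - F (a + 1) x - F (a + 1) x + F a x"
        by (simp add: g_def D_def F_def add.assoc) 
      moreover have "a + 1 \<notin> T" "a + 2 \<notin> T" by (auto simp: T)
      ultimately show ?thesis using vanish that by simp
    qed
    obtain d1 where d1: "d = Suc d1"
    proof (cases d)
      case 0
      then have "g x = 0" for x using D by (simp add: g_def)
      then show ?thesis using a(1) gF by (auto simp: T_def nonzeros_def)
    qed
    then have "deg_less d1 (\<lambda>x. D (x + unit_at v 1) - D x)" using D by simp
    from deg_less_shift[OF this, of "unit_at v a"] have g: "deg_less d1 g"
      by (simp add: g_def[abs_def])
    obtain d' where d': "d1 = Suc d'" using pos[OF a(1) g gF] by auto
    then show ?thesis using slice[OF a(1) _ gF, of d'] g 3 d1
      by (simp add: power_mult_distrib)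
  qed
  also have "\<dots> \<le> 3 ^ d * (card (nonzeros (insert v V) f))\<^sup>2"
    using le by (intro mult_left_mono power_mono) auto
  finally show ?case using insert by simp
qed

section \<open>Permutations and zero divisors in \<int>/3\<close>

text \<open>R is the graph of a permutation s. Its values sum to 0 + 1 + 2 = 0, so s 2 = - s 0 - s 1
  = 2 s 1 - s 0 modulo 3, which is exactly the value at 2 of the affine map through the values at 0
  and 1.\<close>

lemma perm_3_affine:
  assumes R: "card R = 3"
    and fst: "\<And>a b b'. (a, b) \<in> R \<Longrightarrow> (a, b') \<in> R \<Longrightarrow> b = b'"
    and snd: "\<And>a a' b. (a, b) \<in> R \<Longrightarrow> (a', b) \<in> R \<Longrightarrow> a = a'"
  shows "\<exists>p q :: 3. \<forall>a b :: 3. (a, b) \<in> R \<longleftrightarrow> b = p * a + q"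
proof -
  have "inj_on fst R" using fst by (auto simp: inj_on_def)
  then have "card (fst ` R) = CARD(3)" using R by (simp add: card_image)
  then have "fst ` R = UNIV" by (intro card_subset_eq) auto
  then have "\<forall>a. \<exists>b. (a, b) \<in> R" by (metis UNIV_I imageE prod.collapse)
  then obtain s where s: "\<And>a. (a, s a) \<in> R" by metis
  have Rs: "(a, b) \<in> R \<longleftrightarrow> b = s a" for a b using s fst by blast
  have "inj s" using snd s by (metis injI)
  then have "bij s" by (simp add: finite_UNIV_inj_surj bij_def)
  then have "(\<Sum>a\<in>UNIV. s a) = (\<Sum>a\<in>UNIV. a)"
    by (rule sum.reindex_bij_betw)
  then have "s 0 + (s 1 + s 2) = 0"
    unfolding UNIV_3[of 0] by simp
  then have s2: "s 2 = - s 0 - s 1" by (simp add: algebra_simps eq_neg_iff_add_eq_0)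
  have three: "x + x + x = 0" for x :: 3
  proof -
    have "x \<in> {0, 0 + 1, 0 + 2}" using UNIV_3[of 0] by blast
    then show ?thesis by auto
  qed
  have "s a = (s 1 - s 0) * a + s 0" for a
  proof -
    have "a \<in> {0, 0 + 1, 0 + 2}" using UNIV_3[of 0] by blast
    then consider "a = 0" | "a = 1" | "a = 2" by auto
    then show ?thesis
    proof cases
      case 3
      have "(s 1 - s 0) * 2 + s 0 = s 2 + (s 1 + s 1 + s 1)"
        by (simp add: s2 algebra_simps)
      also have "s 1 + s 1 + s 1 = 0" by (rule three)
      finally show ?thesis using 3 by simp
    qed simp_all
  qed
  then show ?thesis using Rs by metis
qed

text \<open>Primality of 3, checked on all pairs of residues. It makes a product of forms vanish
  only where some factor does.\<close>

lemma mult_eq_0_3: "x * y = 0 \<longleftrightarrow> x = 0 \<or> y = (0 :: 3)"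
proof -
  have "x \<in> {0, 0 + 1, 0 + 2}" "y \<in> {0, 0 + 1, 0 + 2}" using UNIV_3[of 0] by blast+
  then show ?thesis by auto
qed

subsection \<open>Covers and their colorings\<close>

lemma multigraph_endsE:
  assumes "multigraph G" "e \<in> edges G"
  obtains u v where "u \<in> verts G" "v \<in> verts G" "u \<noteq> v" "ends G e = {u, v}"
  using assms unfolding multigraph_def by meson

lemma
  assumes "cover G L H M"
  shows cover_multigraph: "multigraph H"
    and cover_verts: "verts H = (\<Union>v\<in>verts G. L v)"
    and cover_lists: "v \<in> verts G \<Longrightarrow> \<exists>A. finite A \<and> A \<noteq> {} \<and> L v = {v} \<times> A"
    and cover_matching: "e \<in> edges G \<Longrightarrow> matching H (M e)"
    and cover_matching_across: "e \<in> edges G \<Longrightarrow> ends G e = {u, v} \<Longrightarrow> M e \<subseteq> edges_across H (L u) (L v)"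
    and cover_complete: "u \<in> verts G \<Longrightarrow> induces_complete H (L u)"
    and cover_disjoint: "e \<in> edges G \<Longrightarrow> e' \<in> edges G \<Longrightarrow> e \<noteq> e' \<Longrightarrow> M e \<inter> M e' = {}"
    and cover_across: "u \<in> verts G \<Longrightarrow> v \<in> verts G \<Longrightarrow> u \<noteq> v \<Longrightarrow>
      edges_across H (L u) (L v) = (\<Union>e\<in>edges_between G u v. M e)"
  using assms by (auto simp: cover_def)

lemma cover_fst:
  assumes "cover G L H M" "v \<in> verts G" "x \<in> L v"
  shows "fst x = v"
proof -
  obtain A where "L v = {v} \<times> A" using cover_lists[OF assms(1,2)] by blast
  then show ?thesis using assms by auto
qed

lemma cover_matching_unique:
  assumes "cover G L H M" "e \<in> edges G" "f \<in> M e" "g \<in> M e" "x \<in> ends H f" "x \<in> ends H g"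
  shows "f = g"
  using cover_matching[OF assms(1,2)] assms(3-6) unfolding matching_def by blast

lemma cover_edge_in_matching:
  assumes "cover G L H M" "u \<in> verts G" "v \<in> verts G" "u \<noteq> v" "x \<in> L u" "y \<in> L v"
    "f \<in> edges H" "ends H f = {x, y}"
  obtains e where "e \<in> edges G" "ends G e = {u, v}" "f \<in> M e"
proof -
  have "f \<in> edges_across H (L u) (L v)" using assms by (auto simp: edges_across_def)
  moreover have "edges_across H (L u) (L v) = (\<Union>e\<in>edges_between G u v. M e)"
    using assms(1-4) by (rule cover_across)
  ultimately show ?thesis using that by (auto simp: edges_between_def)
qed

lemma transversal_in_colorings:
  assumes C: "cover G L H M" and c: "\<And>v. v \<in> verts G \<Longrightarrow> c v \<in> L v"
    and ind: "\<And>f. f \<in> edges H \<Longrightarrow> \<not> ends H f \<subseteq> c ` verts G"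
  shows "c ` verts G \<in> colorings G H"
proof -
  have "inj_on c (verts G)"
    using cover_fst[OF C _ c] by (metis inj_onI)
  moreover have "c ` verts G \<subseteq> verts H"
    using cover_verts[OF C] c by blast
  ultimately show ?thesis
    using ind by (simp add: colorings_def independent_set_def card_image)
qed

text \<open>Lists are cliques, so an independent set meets each of them at most once; having as many
  elements as G has vertices, it meets each exactly once.\<close>

lemma colorings_transversal:
  assumes G: "multigraph G" and C: "cover G L H M" and I: "I \<in> colorings G H"
  obtains c where "\<And>v. v \<in> verts G \<Longrightarrow> c v \<in> L v" "I = c ` verts G"
proof -
  have VH: "verts H = (\<Union>v\<in>verts G. L v)" using C by (rule cover_verts)
  have sub: "I \<subseteq> verts H" and ind: "\<And>f. f \<in> edges H \<Longrightarrow> \<not> ends H f \<subseteq> I"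
    and card: "card I = card (verts G)"
    using I by (auto simp: colorings_def independent_set_def)
  have fst: "fst x \<in> verts G \<and> x \<in> L (fst x)" if x: "x \<in> I" for x
  proof -
    obtain v where "v \<in> verts G" "x \<in> L v" using x sub VH by auto
    then show ?thesis using cover_fst[OF C] by metis
  qed
  have inj: "inj_on fst I"
  proof (rule inj_onI, rule ccontr)
    fix x y assume xy: "x \<in> I" "y \<in> I" "fst x = fst y" "x \<noteq> y"
    then have L: "fst x \<in> verts G" "x \<in> L (fst x)" "y \<in> L (fst x)" using fst by metis+
    then have "induces_complete H (L (fst x))"
      using cover_complete[OF C] by blast
    then obtain f where "f \<in> edges_between H x y"
      using L xy(4) unfolding induces_complete_def by meson
    then show False using ind[of f] xy by (auto simp: edges_between_def)
  qed
  have "fst ` I = verts G"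
    using G fst card card_image[OF inj] by (intro card_subset_eq) (auto simp: multigraph_def)
  then have bij: "bij_betw fst I (verts G)" using inj by (simp add: bij_betw_def)
  show ?thesis
  proof
    show "I = inv_into I fst ` verts G"
      using bij_betw_inv_into[OF bij] by (simp add: bij_betw_def)
    show "inv_into I fst v \<in> L v" if "v \<in> verts G" for v
      using that fst by (metis \<open>fst ` I = verts G\<close> f_inv_into_f inv_into_into)
  qed
qed

section \<open>The DP-chromatic number: attainment and monotonicity\<close>

text \<open>A deliberately crude greedy bound, wanted only as a witness for the \<open>LEAST\<close>
  in \<open>dp_chromatic_number\<close>: each edge of G blocks at most one label of the vertex being
  colored.\<close>

lemma large_cover_colorable:
  assumes G: "multigraph G" and C: "fold_cover k G L H M" and k: "card (edges G) < k"
  shows "colorings G H \<noteq> {}"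
proof -
  have cov: "cover G L H M" and cL: "\<And>v. v \<in> verts G \<Longrightarrow> card (L v) = k"
    using C by (auto simp: fold_cover_def)
  have H: "multigraph H" using cov by (rule cover_multigraph)
  have fin: "finite (verts G)" "finite (edges G)" using G by (auto simp: multigraph_def)
  have "\<exists>c. (\<forall>v\<in>S. c v \<in> L v) \<and> (\<forall>f\<in>edges H. \<not> ends H f \<subseteq> c ` S)"
    if "finite S" "S \<subseteq> verts G" for S
    using that
  proof (induction S rule: finite_induct)
    case empty
    have "ends H f \<noteq> {}" if "f \<in> edges H" for f
      using multigraph_endsE[OF H that] by blast
    then show ?case by simp
  next
    case (insert v S)
    then have "\<exists>c. (\<forall>v\<in>S. c v \<in> L v) \<and> (\<forall>f\<in>edges H. \<not> ends H f \<subseteq> c ` S)" by simp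
    then obtain c where c: "\<And>v. v \<in> S \<Longrightarrow> c v \<in> L v"
      and ind: "\<And>f. f \<in> edges H \<Longrightarrow> \<not> ends H f \<subseteq> c ` S" by blast
    have S: "S \<subseteq> verts G" "v \<in> verts G" "v \<notin> S" using insert by auto
    define B where "B = {x \<in> L v. \<exists>f\<in>edges H. \<exists>u\<in>S. ends H f = {x, c u}}"
    \<comment> \<open>\<open>Q x e\<close> says that the matching of \<open>e\<close> is to blame
      for blocking \<open>x\<close>. A matching has at most one edge at the label already chosen for
      the other end of \<open>e\<close>, so blame is injective and \<open>B\<close> has at most
      \<open>card (edges G)\<close> elements.\<close>
    define Q where "Q x e \<longleftrightarrow> e \<in> edges G \<and>
      (\<exists>u\<in>S. \<exists>f\<in>M e. ends H f = {x, c u} \<and> ends G e = {v, u})" for x e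
    have "\<exists>e. Q x e" if x: "x \<in> B" for x
    proof -
      obtain f u where fu: "x \<in> L v" "f \<in> edges H" "u \<in> S" "ends H f = {x, c u}"
        using x by (auto simp: B_def)
      have u: "u \<in> verts G" "v \<noteq> u" using S fu(3) by auto
      obtain e where "e \<in> edges G" "ends G e = {v, u}" "f \<in> M e"
        by (rule cover_edge_in_matching[OF cov S(2) u fu(1) c[OF fu(3)] fu(2,4)])
      then show ?thesis using fu unfolding Q_def by blast
    qed
    then obtain \<epsilon> where \<epsilon>: "\<And>x. x \<in> B \<Longrightarrow> Q x (\<epsilon> x)" by metis
    have "inj_on \<epsilon> B"
    proof (rule inj_onI)
      fix x y assume xy: "x \<in> B" "y \<in> B" "\<epsilon> x = \<epsilon> y"
      obtain u f where f: "f \<in> M (\<epsilon> x)" "ends H f = {x, c u}" "ends G (\<epsilon> x) = {v, u}" "\<epsilon> x \<in> edges G"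
        using \<epsilon>[OF xy(1)] unfolding Q_def by blast
      obtain w g where g: "g \<in> M (\<epsilon> x)" "ends H g = {y, c w}" "ends G (\<epsilon> x) = {v, w}"
        using \<epsilon>[OF xy(2)] xy(3) unfolding Q_def by auto
      have u: "w = u" using f(3) g(3) by (auto simp: doubleton_eq_iff)
      have "f = g"
        by (rule cover_matching_unique[OF cov f(4,1) g(1), of "c u"]) (simp_all add: f g u)
      then have "{x, c u} = {y, c u}" using f(2) g(2) u by simp
      then show "x = y" by (auto simp: doubleton_eq_iff)
    qed
    moreover have "\<epsilon> ` B \<subseteq> edges G" using \<epsilon> by (auto simp: Q_def)
    ultimately have "card B \<le> card (edges G)" using fin(2) card_inj_on_le[of \<epsilon> B "edges G"] by blast
    then have "B \<noteq> L v" using cL[OF S(2)] k by auto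
    moreover have "B \<subseteq> L v" by (auto simp: B_def)
    ultimately obtain x where x: "x \<in> L v" "x \<notin> B" by blast
    have "\<not> ends H f \<subseteq> (c(v := x)) ` insert v S" if f: "f \<in> edges H" for f
    proof
      assume sub: "ends H f \<subseteq> (c(v := x)) ` insert v S"
      have "(c(v := x)) ` insert v S = insert x (c ` S)" using S(3) by auto
      then have sub: "ends H f \<subseteq> insert x (c ` S)" using sub by simp
      obtain y z where yz: "y \<noteq> z" "ends H f = {y, z}" using multigraph_endsE[OF H f] by metis
      have "\<not> ends H f \<subseteq> c ` S" using ind f by simp
      then have "y = x \<and> z \<in> c ` S \<or> z = x \<and> y \<in> c ` S" using sub yz by auto
      then have "\<exists>w\<in>c ` S. ends H f = {x, w}" using yz(2) insert_commute[of x y "{}"] by blast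
      then obtain w where "w \<in> c ` S" "ends H f = {x, w}" by blast
      then have "x \<in> B" using x(1) f by (auto simp: B_def)
      then show False using x(2) by simp
    qed
    moreover have "\<forall>w\<in>insert v S. (c(v := x)) w \<in> L w" using c x(1) S(3) by auto
    ultimately show ?case by blast
  qed
  from this[OF fin(1) order_refl] obtain c where c: "\<forall>v\<in>verts G. c v \<in> L v"
    "\<forall>f\<in>edges H. \<not> ends H f \<subseteq> c ` verts G" by blast
  have "c ` verts G \<in> colorings G H"
    using c by (intro transversal_in_colorings[OF cov]) simp_all
  then show ?thesis by blast
qed

text \<open>Shrink every list to k labels and take the induced subgraph of H. Independence in an
  induced subgraph is independence in H, and the required size \<open>card (verts G)\<close> does
  not depend on the lists.\<close>

lemma fold_cover_restrict:
  fixes L :: "'v \<Rightarrow> ('v \<times> 'c) set" and H :: "('v \<times> 'c, 'f) multigraph"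
  assumes G: "multigraph G" and C: "fold_cover m G L H M" and k: "0 < k" "k \<le> m"
  obtains L' :: "'v \<Rightarrow> ('v \<times> 'c) set" and H' :: "('v \<times> 'c, 'f) multigraph" and M'
    where "fold_cover k G L' H' M'" "colorings G H' \<subseteq> colorings G H"
proof -
  have cov: "cover G L H M" and cL: "\<And>v. v \<in> verts G \<Longrightarrow> card (L v) = m"
    using C by (auto simp: fold_cover_def)
  have H: "multigraph H" using cov by (rule cover_multigraph)
  have "\<exists>A \<subseteq> L v. card A = k" if "v \<in> verts G" for v
    using cL[OF that] k by (metis obtain_subset_with_card_n)
  then obtain L' where L': "\<And>v. v \<in> verts G \<Longrightarrow> L' v \<subseteq> L v" "\<And>v. v \<in> verts G \<Longrightarrow> card (L' v) = k"
    by metis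
  define W where "W = (\<Union>v\<in>verts G. L' v)"
  define E' where "E' = {f \<in> edges H. ends H f \<subseteq> W}"
  define H' where "H' = \<lparr>verts = W, edges = E', ends = ends H\<rparr>"
  have H'_simps: "verts H' = W" "edges H' = E'" "ends H' = ends H" by (simp_all add: H'_def)
  have VH: "verts H = (\<Union>v\<in>verts G. L v)" using cov by (rule cover_verts)
  \<comment> \<open>Lists of distinct vertices are disjoint, so a surviving label of
    \<open>L v\<close> can only have survived in \<open>L' v\<close>.\<close>
  have WL: "x \<in> L' v" if x: "x \<in> W" "x \<in> L v" "v \<in> verts G" for x v
  proof -
    obtain w where w: "w \<in> verts G" "x \<in> L' w" using x(1) by (auto simp: W_def)
    then have "w = v" using cover_fst[OF cov] L'(1) x by (metis subsetD)
    then show ?thesis using w by simp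
  qed
  have W: "W \<subseteq> verts H" using L'(1) by (auto simp: VH W_def)
  have fin: "finite (verts H)" "finite (edges H)" using H by (auto simp: multigraph_def)
  have across: "edges_across H' (L' u) (L' v) = edges_across H (L u) (L v) \<inter> E'"
    if "u \<in> verts G" "v \<in> verts G" for u v
  proof (intro equalityI subsetI)
    fix f assume "f \<in> edges_across H' (L' u) (L' v)"
    then show "f \<in> edges_across H (L u) (L v) \<inter> E'"
      using L'(1) that unfolding edges_across_def H'_simps E'_def by blast
  next
    fix f assume f: "f \<in> edges_across H (L u) (L v) \<inter> E'"
    then obtain x y where xy: "x \<in> L u" "y \<in> L v" "ends H f = {x, y}"
      by (auto simp: edges_across_def)
    then have "x \<in> L' u" "y \<in> L' v" using WL that f by (auto simp: E'_def)
    then show "f \<in> edges_across H' (L' u) (L' v)"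
      using f xy by (auto simp: edges_across_def H'_simps)
  qed
  have "cover G L' H' (\<lambda>e. M e \<inter> E')"
    unfolding cover_def
  proof (intro conjI)
    have "W \<noteq> {}" 
    proof -
      obtain v where v: "v \<in> verts G" using G by (auto simp: multigraph_def)
      then have "L' v \<noteq> {}" using L'(2)[OF v] k by auto
      then show ?thesis using v by (auto simp: W_def)
    qed
    moreover have "\<exists>u\<in>W. \<exists>v\<in>W. u \<noteq> v \<and> ends H e = {u, v}" if "e \<in> E'" for e
    proof -
      have "e \<in> edges H" "ends H e \<subseteq> W" using that by (auto simp: E'_def)
      then obtain u v where "u \<noteq> v" "ends H e = {u, v}" "{u, v} \<subseteq> W"
        using multigraph_endsE[OF H] by metis
      then show ?thesis by auto
    qed
    moreover have "finite E'" using fin by (simp add: E'_def)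
    moreover have "finite W" using fin W finite_subset by blast
    ultimately show "multigraph H'"
      by (simp add: multigraph_def H'_simps)
    show "\<forall>v\<in>verts G. \<exists>A. finite A \<and> A \<noteq> {} \<and> L' v = {v} \<times> A"
    proof
      fix v assume v: "v \<in> verts G"
      have "fst x = v" if "x \<in> L' v" for x using that v L'(1) cover_fst[OF cov] by blast
      then have "L' v = {v} \<times> snd ` L' v" by force
      moreover have "finite (L' v)" "L' v \<noteq> {}"
        using L'(2)[OF v] k by (auto intro: card_ge_0_finite)
      ultimately show "\<exists>A. finite A \<and> A \<noteq> {} \<and> L' v = {v} \<times> A" by blast
    qed
    show "verts H' = (\<Union>v\<in>verts G. L' v)" by (simp add: H'_simps W_def)
    show "\<forall>e\<in>edges G. matching H' (M e \<inter> E')"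
      using cover_matching[OF cov] by (auto simp: matching_def H'_simps)
    show "\<forall>e\<in>edges G. \<forall>u v. ends G e = {u, v} \<longrightarrow> M e \<inter> E' \<subseteq> edges_across H' (L' u) (L' v)"
    proof (intro ballI allI impI)
      fix e u v assume e: "e \<in> edges G" "ends G e = {u, v}"
      then have uv: "u \<in> verts G" "v \<in> verts G"
        using G unfolding multigraph_def by fastforce+
      have "M e \<subseteq> edges_across H (L u) (L v)"
        using cov e by (rule cover_matching_across)
      then show "M e \<inter> E' \<subseteq> edges_across H' (L' u) (L' v)"
        using across[OF uv] by auto
    qed
    show "\<forall>u\<in>verts G. induces_complete H' (L' u)"
    proof
      fix u assume u: "u \<in> verts G"
      have c: "induces_complete H (L u)" using cov u by (rule cover_complete)
      have eq: "edges_between H' x y = edges_between H x y" if "x \<in> L' u" "y \<in> L' u" for x y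
        using that u by (auto simp: edges_between_def H'_simps E'_def W_def)
      show "induces_complete H' (L' u)"
        unfolding induces_complete_def
      proof (intro ballI impI)
        fix x y assume xy: "x \<in> L' u" "y \<in> L' u" "x \<noteq> y"
        then have L: "x \<in> L u" "y \<in> L u" using L'(1)[OF u] by auto
        show "\<exists>!e. e \<in> edges_between H' x y"
          unfolding eq[OF xy(1,2)] by (rule c[unfolded induces_complete_def, rule_format, OF L xy(3)])
      qed
    qed
    show "\<forall>e1\<in>edges G. \<forall>e2\<in>edges G. e1 \<noteq> e2 \<longrightarrow> (M e1 \<inter> E') \<inter> (M e2 \<inter> E') = {}"
      using cover_disjoint[OF cov] by blast
    show "\<forall>u\<in>verts G. \<forall>v\<in>verts G. u \<noteq> v \<longrightarrow>
        edges_across H' (L' u) (L' v) = (\<Union>e\<in>edges_between G u v. M e \<inter> E')"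
    proof (intro ballI impI)
      fix u v assume uv: "u \<in> verts G" "v \<in> verts G" "u \<noteq> v"
      have "edges_across H (L u) (L v) = (\<Union>e\<in>edges_between G u v. M e)"
        using cov uv by (rule cover_across)
      then show "edges_across H' (L' u) (L' v) = (\<Union>e\<in>edges_between G u v. M e \<inter> E')"
        unfolding across[OF uv(1,2)] by auto
    qed
  qed
  then have "fold_cover k G L' H' (\<lambda>e. M e \<inter> E')" using L' by (simp add: fold_cover_def)
  moreover have "colorings G H' \<subseteq> colorings G H"
    using W unfolding colorings_def independent_set_def H'_simps E'_def by blast
  ultimately show ?thesis using that by blast
qed

lemma fold_cover_colorable:
  fixes L :: "'v \<Rightarrow> ('v \<times> nat) set" and H :: "('v \<times> nat, nat) multigraph"
  assumes G: "multigraph G" and m: "dp_chromatic_number G \<le> m" and C: "fold_cover m G L H M"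
  shows "colorings G H \<noteq> {}"
proof -
  let ?P = "\<lambda>k. 0 < k \<and>
     (\<forall>(L :: 'v \<Rightarrow> ('v \<times> nat) set) (H :: ('v \<times> nat, nat) multigraph) M.
        fold_cover k G L H M \<longrightarrow> colorings G H \<noteq> {})"
  \<comment> \<open>This witness serves only to show that the least number has the property; its
    size is irrelevant.\<close>
  have "?P (Suc (card (edges G)))"
    using large_cover_colorable[OF G] by blast
  then have P: "?P (dp_chromatic_number G)"
    unfolding dp_chromatic_number_def by (rule LeastI)
  obtain L' :: "'v \<Rightarrow> ('v \<times> nat) set" and H' :: "('v \<times> nat, nat) multigraph" and M'
    where "fold_cover (dp_chromatic_number G) G L' H' M'" "colorings G H' \<subseteq> colorings G H"
    using fold_cover_restrict[OF G C _ m] P by blast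
  then show ?thesis using P by blast
qed

section \<open>The DP color function: existence of full covers\<close>

text \<open>The identity cover, in which every edge joins equal labels, provides the witness for the
  \<open>LEAST\<close> in \<open>dp_color_function\<close>.\<close>

lemma full_fold_cover_exists:
  fixes G :: "('v, 'e) multigraph"
  assumes G: "multigraph G" and m: "0 < m"
  shows "\<exists>(L :: 'v \<Rightarrow> ('v \<times> nat) set) (H :: ('v \<times> nat, nat) multigraph) M.
    full_fold_cover m G L H M"
proof -
  have fin: "finite (verts G)" "finite (edges G)" "verts G \<noteq> {}"
    using G by (auto simp: multigraph_def)
  define L :: "'v \<Rightarrow> ('v \<times> nat) set" where "L v = {v} \<times> {..<m}" for v
  define K where "K = {S. \<exists>v\<in>verts G. S \<subseteq> L v \<and> card S = 2}"
  \<comment> \<open>Edges of H are tagged: \<open>Inl (e, i)\<close> is the copy of \<open>e\<close>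
    at label i, so parallel edges get disjoint matchings, and \<open>Inr S\<close> is the list edge
    with ends \<open>S\<close>.\<close>
  define M :: "'e \<Rightarrow> ('e \<times> nat + ('v \<times> nat) set) set" where "M e = Inl ` ({e} \<times> {..<m})" for e
  define H where "H = \<lparr>verts = verts G \<times> {..<m}, edges = Inl ` (edges G \<times> {..<m}) \<union> Inr ` K,
     ends = case_sum (\<lambda>(e, i). ends G e \<times> {i}) id\<rparr>"
  have H_simps: "verts H = verts G \<times> {..<m}" "edges H = Inl ` (edges G \<times> {..<m}) \<union> Inr ` K"
    "ends H (Inl (e, i)) = ends G e \<times> {i}" "ends H (Inr S) = S" for e i S
    by (simp_all add: H_def)
  have KE: "\<exists>v\<in>verts G. \<exists>i<m. \<exists>j<m. i \<noteq> j \<and> S = {(v, i), (v, j)}" if "S \<in> K" for S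
    using that by (fastforce simp: K_def L_def card_2_iff)
  have across: "edges_across H (L u) (L v) = (\<Union>e\<in>edges_between G u v. M e)"
    if "u \<in> verts G" "v \<in> verts G" "u \<noteq> v" for u v
  proof (intro equalityI subsetI)
    fix f assume f: "f \<in> edges_across H (L u) (L v)"
    then obtain i j where ij: "i < m" "j < m" "ends H f = {(u, i), (v, j)}" "f \<in> edges H"
      by (auto simp: edges_across_def L_def)
    show "f \<in> (\<Union>e\<in>edges_between G u v. M e)"
    proof (cases f)
      case (Inl p)
      then obtain e k where p: "f = Inl (e, k)" "e \<in> edges G" "k < m"
        using ij(4) by (auto simp: H_simps)
      have "fst ` ends H f = {u, v}" using ij(3) by simp
      then have "ends G e = {u, v}" by (simp add: p H_simps)
      then show ?thesis using p by (auto simp: edges_between_def M_def)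
    next
      case (Inr S)
      then have "S \<in> K" using ij(4) by (auto simp: H_simps)
      then obtain w a b where "ends H f = {(w, a), (w, b)}" using KE Inr H_simps(4) by metis
      then have "{(w, a), (w, b)} = {(u, i), (v, j)}" using ij(3) by simp
      then show ?thesis using \<open>u \<noteq> v\<close> by (auto simp: doubleton_eq_iff)
    qed
  next
    fix f assume "f \<in> (\<Union>e\<in>edges_between G u v. M e)"
    then obtain e k where e: "f = Inl (e, k)" "e \<in> edges G" "k < m" "ends G e = {u, v}"
      by (auto simp: edges_between_def M_def)
    then have "ends H f = {(u, k), (v, k)}" by (auto simp: H_simps)
    then show "f \<in> edges_across H (L u) (L v)"
      using e by (auto simp: edges_across_def L_def H_simps)
  qed
  have "cover G L H M"
    unfolding cover_def
  proof (intro conjI)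
    have "\<exists>x\<in>verts H. \<exists>y\<in>verts H. x \<noteq> y \<and> ends H f = {x, y}" if f: "f \<in> edges H" for f
    proof (cases f)
      case (Inl p)
      then obtain e k where p: "f = Inl (e, k)" "e \<in> edges G" "k < m"
        using f by (auto simp: H_simps)
      obtain u v where "u \<in> verts G" "v \<in> verts G" "u \<noteq> v" "ends G e = {u, v}"
        using multigraph_endsE[OF G p(2)] by blast
      then show ?thesis
        by (intro bexI[of _ "(u, k)"] bexI[of _ "(v, k)"]) (auto simp: H_simps p)
    next
      case (Inr S)
      then have "S \<in> K" using f by (auto simp: H_simps)
      from KE[OF this] show ?thesis by (auto simp: Inr H_simps)
    qed
    moreover have "finite K"
      by (rule finite_subset[of _ "Pow (verts G \<times> {..<m})"])
        (use fin in \<open>auto simp: K_def L_def\<close>)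
    ultimately show "multigraph H"
      using fin m by (auto simp: multigraph_def H_simps)
    show "\<forall>v\<in>verts G. \<exists>A. finite A \<and> A \<noteq> {} \<and> L v = {v} \<times> A"
      using m by (auto simp: L_def)
    show "verts H = (\<Union>v\<in>verts G. L v)" by (auto simp: H_simps L_def)
    show "\<forall>e\<in>edges G. matching H (M e)"
      by (auto simp: matching_def M_def H_simps)
    show "\<forall>e\<in>edges G. \<forall>u v. ends G e = {u, v} \<longrightarrow> M e \<subseteq> edges_across H (L u) (L v)"
    proof (intro ballI allI impI)
      fix e u v assume e: "e \<in> edges G" "ends G e = {u, v}"
      then have uv: "u \<in> verts G" "v \<in> verts G" "u \<noteq> v"
        using G unfolding multigraph_def by fastforce+
      show "M e \<subseteq> edges_across H (L u) (L v)"
        unfolding across[OF uv] using e by (auto simp: edges_between_def)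
    qed
    show "\<forall>u\<in>verts G. induces_complete H (L u)"
    proof
      fix u assume u: "u \<in> verts G"
      show "induces_complete H (L u)"
        unfolding induces_complete_def
      proof (intro ballI impI)
        fix x y assume xy: "x \<in> L u" "y \<in> L u" "x \<noteq> y"
        then have "{x, y} \<in> K" using u by (auto simp: K_def)
        have "edges_between H x y = {Inr {x, y}}"
        proof (intro equalityI subsetI)
          fix f assume f: "f \<in> edges_between H x y"
          show "f \<in> {Inr {x, y}}"
          proof (cases f)
            case (Inl p)
            then obtain e k where p: "f = Inl (e, k)" "e \<in> edges G"
              using f by (auto simp: edges_between_def H_simps)
            obtain v w where vw: "v \<noteq> w" "ends G e = {v, w}"
              by (rule multigraph_endsE[OF G p(2)])
            have "fst x = u" "fst y = u" using xy(1,2) by (auto simp: L_def)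
            moreover have "ends H f = {x, y}" using f by (simp add: edges_between_def)
            \<comment> \<open>A matching edge projects onto two distinct vertices of G, so it cannot
              lie inside a single list.\<close>
            ultimately have "fst ` ends H f = {u}" by simp
            moreover have "fst ` ends H f = ends G e" by (simp add: p(1) H_simps)
            ultimately show ?thesis using vw by (metis doubleton_eq_iff insert_absorb2)
          qed (use f in \<open>auto simp: edges_between_def H_simps\<close>)
        next
          fix f assume "f \<in> {Inr {x, y} :: 'e \<times> nat + ('v \<times> nat) set}"
          then show "f \<in> edges_between H x y"
            using \<open>{x, y} \<in> K\<close> by (auto simp: edges_between_def H_simps)
        qed
        then show "\<exists>!e. e \<in> edges_between H x y" by simp
      qed
    qed
    show "\<forall>e1\<in>edges G. \<forall>e2\<in>edges G. e1 \<noteq> e2 \<longrightarrow> M e1 \<inter> M e2 = {}"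
      by (auto simp: M_def)
    show "\<forall>u\<in>verts G. \<forall>v\<in>verts G. u \<noteq> v \<longrightarrow>
        edges_across H (L u) (L v) = (\<Union>e\<in>edges_between G u v. M e)"
      using across by blast
  qed
  \<comment> \<open>The tagged edges are renamed to natural numbers, the type over which
    \<open>dp_color_function\<close> minimizes.\<close>
  from cover_nat[OF G this]
  obtain g :: "nat \<Rightarrow> nat" and h :: "'e \<times> nat + ('v \<times> nat) set \<Rightarrow> nat"
    and L' :: "'v \<Rightarrow> ('v \<times> nat) set" and H' :: "('v \<times> nat, nat) multigraph" and M'
    where g: "inj_on (map_prod id g) (verts H)" and h: "inj_on h (edges H)"
    and L': "\<And>v. L' v = map_prod id g ` L v" and M': "\<And>e. M' e = h ` M e"
    and cov: "cover G L' H' M'"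
    by metis
  have "card (L' v) = m" if "v \<in> verts G" for v
  proof -
    have "L v \<subseteq> verts H" using that by (auto simp: L_def H_simps)
    then have "card (L' v) = card (L v)"
      unfolding L' using g by (intro card_image) (rule inj_on_subset)
    then show ?thesis by (simp add: L_def card_cartesian_product)
  qed
  moreover have "card (edges_across H' (L' u) (L' v)) = card (edges_between G u v) * m"
    if uv: "u \<in> verts G" "v \<in> verts G" "u \<noteq> v" for u v
  proof -
    have "edges_across H' (L' u) (L' v) = (\<Union>e\<in>edges_between G u v. M' e)"
      using cov uv by (rule cover_across)
    also have "\<dots> = h ` Inl ` (edges_between G u v \<times> {..<m})"
      by (auto simp: M' M_def)
    also have "card \<dots> = card (Inl ` (edges_between G u v \<times> {..<m}) :: ('e \<times> nat + ('v \<times> nat) set) set)"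
      by (intro card_image inj_on_subset[OF h]) (auto simp: H_simps edges_between_def)
    also have "\<dots> = card (edges_between G u v) * m"
      by (simp add: card_image card_cartesian_product)
    finally show ?thesis .
  qed
  ultimately have "full_fold_cover m G L' H' M'"
    using cov by (simp add: full_fold_cover_def fold_cover_def)
  then show ?thesis by blast
qed

section \<open>From full covers to affine forms\<close>

lemma matching_endsE:
  assumes "multigraph G" "cover G L H M" "e \<in> edges G" "ends G e = {u, v}" "f \<in> M e"
  obtains x y where "x \<in> L u" "y \<in> L v" "ends H f = {x, y}"
proof -
  have "M e \<subseteq> edges_across H (L u) (L v)"
    using assms(2-4) by (rule cover_matching_across)
  then show ?thesis using assms(5) that by (auto simp: edges_across_def)
qed

lemma card_matching_le:
  assumes G: "multigraph G" and C: "fold_cover m G L H M"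
    and e: "e \<in> edges G" "ends G e = {u, v}"
  shows "card (M e) \<le> m"
proof -
  have cov: "cover G L H M" and cL: "\<And>v. v \<in> verts G \<Longrightarrow> card (L v) = m"
    using C by (auto simp: fold_cover_def)
  have u: "u \<in> verts G" using e G unfolding multigraph_def by fastforce
  have "\<forall>f\<in>M e. \<exists>x. x \<in> L u \<and> x \<in> ends H f"
    using matching_endsE[OF G cov e] by (metis insertI1)
  then obtain \<xi> where \<xi>: "\<And>f. f \<in> M e \<Longrightarrow> \<xi> f \<in> L u \<and> \<xi> f \<in> ends H f" by metis
  have "inj_on \<xi> (M e)"
  proof (rule inj_onI)
    fix f g assume "f \<in> M e" "g \<in> M e" "\<xi> f = \<xi> g"
    then show "f = g"
      using \<xi>[of f] \<xi>[of g] by (intro cover_matching_unique[OF cov e(1), of f g "\<xi> f"]) auto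
  qed
  moreover have "finite (L u)" using cover_lists[OF cov u] by auto
  ultimately show ?thesis using \<xi> cL[OF u] card_inj_on_le[of \<xi> "M e" "L u"] by auto
qed

text \<open>Fullness prescribes only the total over all parallel edges. Each matching contributes at
  most m, so equality of the sums forces equality in every term.\<close>

lemma card_matching_full:
  assumes G: "multigraph G" and C: "full_fold_cover m G L H M"
    and e: "e \<in> edges G" "ends G e = {u, v}"
  shows "card (M e) = m"
proof -
  have fold: "fold_cover m G L H M" using C by (simp add: full_fold_cover_def)
  then have cov: "cover G L H M" by (simp add: fold_cover_def)
  have uv: "u \<in> verts G" "v \<in> verts G" "u \<noteq> v"
    using e G unfolding multigraph_def by fastforce+
  have fin: "finite (edges_between G u v)" 
    using G by (simp add: multigraph_def edges_between_def)
  have "finite (edges H)" using cover_multigraph[OF cov] by (simp add: multigraph_def)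
  then have finM: "finite (M e)" if "e \<in> edges G" for e
    using cover_matching[OF cov that] unfolding matching_def by (metis finite_subset)
  have sub: "edges_between G u v \<subseteq> edges G" by (auto simp: edges_between_def)
  have "(\<Sum>e\<in>edges_between G u v. card (M e)) = card (\<Union>e\<in>edges_between G u v. M e)"
    using cover_disjoint[OF cov] sub finM fin by (subst card_UN_disjoint) blast+
  also have "(\<Union>e\<in>edges_between G u v. M e) = edges_across H (L u) (L v)"
    using cover_across[OF cov uv] by simp
  also have "card \<dots> = (\<Sum>e\<in>edges_between G u v. m)"
    using C uv by (simp add: full_fold_cover_def)
  finally have sum: "(\<Sum>e\<in>edges_between G u v. card (M e)) = (\<Sum>e\<in>edges_between G u v. m)" .
  show ?thesis
    by (rule sum_mono_inv[OF sum _ _ fin]) (use e card_matching_le[OF G fold] in \<open>auto simp: edges_between_def\<close>)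
qed

text \<open>Read through the labellings, a matching is a relation on \<int>/3. Fullness gives it
  three pairs, and the matching property makes it functional in both directions, so
  \<open>perm_3_affine\<close> applies.\<close>

lemma matching_affine:
  fixes \<phi> :: "'v \<Rightarrow> 3 \<Rightarrow> 'v \<times> 'c"
  assumes G: "multigraph G" and C: "full_fold_cover 3 G L H M"
    and e: "e \<in> edges G" "ends G e = {u, v}"
    and \<phi>: "\<And>w. w \<in> verts G \<Longrightarrow> bij_betw (\<phi> w) UNIV (L w)"
  shows "\<exists>p q. \<forall>a b. (\<exists>f\<in>M e. ends H f = {\<phi> u a, \<phi> v b}) \<longleftrightarrow> b = p * a + q"
proof -
  have cov: "cover G L H M" using C by (simp add: full_fold_cover_def fold_cover_def)
  have uv: "u \<in> verts G" "v \<in> verts G" "u \<noteq> v"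
    using e G unfolding multigraph_def by fastforce+
  have fst\<phi>: "fst (\<phi> w a) = w" if "w \<in> verts G" for w a
  proof (rule cover_fst[OF cov that])
    show "\<phi> w a \<in> L w" using \<phi>[OF that] by (auto simp: bij_betw_def)
  qed
  have inj: "\<phi> w a = \<phi> w b \<longleftrightarrow> a = b" if "w \<in> verts G" for w a b
    using \<phi>[OF that] by (auto simp: bij_betw_def inj_on_def)
  \<comment> \<open>Ends in H are unordered, but first components tell them apart, so the ordered
    pair of labels can be recovered.\<close>
  have inj2: "{\<phi> u a, \<phi> v b} = {\<phi> u a', \<phi> v b'} \<longleftrightarrow> a = a' \<and> b = b'" for a b a' b'
    using inj uv fst\<phi> by (metis doubleton_eq_iff)
  have "\<exists>a b. ends H f = {\<phi> u a, \<phi> v b}" if f: "f \<in> M e" for f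
  proof -
    obtain x y where xy: "x \<in> L u" "y \<in> L v" "ends H f = {x, y}"
      using matching_endsE[OF G cov e f] by blast
    then have "x \<in> range (\<phi> u)" "y \<in> range (\<phi> v)" using \<phi> uv by (auto simp: bij_betw_def)
    then show ?thesis using xy by auto
  qed
  then obtain \<alpha> \<beta> where \<alpha>\<beta>: "\<And>f. f \<in> M e \<Longrightarrow> ends H f = {\<phi> u (\<alpha> f), \<phi> v (\<beta> f)}" by metis
  define R where "R = {(a, b). \<exists>f\<in>M e. ends H f = {\<phi> u a, \<phi> v b}}"
  have "R = (\<lambda>f. (\<alpha> f, \<beta> f)) ` M e"
    using \<alpha>\<beta> inj2 by (force simp: R_def)
  moreover have "inj_on (\<lambda>f. (\<alpha> f, \<beta> f)) (M e)"
  proof (rule inj_onI)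
    fix f g assume fg: "f \<in> M e" "g \<in> M e" "(\<alpha> f, \<beta> f) = (\<alpha> g, \<beta> g)"
    show "f = g"
      by (rule cover_matching_unique[OF cov e(1) fg(1,2), of "\<phi> u (\<alpha> f)"]) (use \<alpha>\<beta> fg in auto)
  qed
  ultimately have card: "card R = 3" using card_matching_full[OF G C e] by (simp add: card_image)
  have "\<exists>p q. \<forall>a b. (a, b) \<in> R \<longleftrightarrow> b = p * a + q"
  proof (rule perm_3_affine[OF card])
    fix a b b' assume "(a, b) \<in> R" "(a, b') \<in> R"
    then obtain f g where fg: "f \<in> M e" "g \<in> M e" "ends H f = {\<phi> u a, \<phi> v b}" "ends H g = {\<phi> u a, \<phi> v b'}"
      by (auto simp: R_def)
    moreover have "f = g"
      by (rule cover_matching_unique[OF cov e(1) fg(1,2), of "\<phi> u a"]) (use fg in auto)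
    ultimately show "b = b'" using inj2 by metis
  next
    fix a a' b assume "(a, b) \<in> R" "(a', b) \<in> R"
    then obtain f g where fg: "f \<in> M e" "g \<in> M e" "ends H f = {\<phi> u a, \<phi> v b}" "ends H g = {\<phi> u a', \<phi> v b}"
      by (auto simp: R_def)
    moreover have "f = g"
      by (rule cover_matching_unique[OF cov e(1) fg(1,2), of "\<phi> v b"]) (use fg in auto)
    ultimately show "a = a'" using inj2 by metis
  qed
  then show ?thesis by (simp add: R_def)
qed

lemma prod_eq_0_3:
  fixes a :: "'e \<Rightarrow> 3"
  assumes "finite E"
  shows "(\<Prod>e\<in>E. a e) = 0 \<longleftrightarrow> (\<exists>e\<in>E. a e = 0)"
  using assms by (induction E rule: finite_induct) (auto simp: mult_eq_0_3)

text \<open>A lower bound needs only that nonzeros inject into colorings; the given coloring is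
  pulled back to show that there is a nonzero at all.\<close>

lemma card_colorings_full_3:
  fixes G :: "('v, 'e) multigraph" and L :: "'v \<Rightarrow> ('v \<times> 'c) set"
  assumes G: "multigraph G" and C: "full_fold_cover 3 G L H M" and ne: "colorings G H \<noteq> {}"
  shows "9 ^ card (verts G) \<le> 3 ^ card (edges G) * (card (colorings G H))\<^sup>2"
proof -
  have cov: "cover G L H M" and cL: "\<And>v. v \<in> verts G \<Longrightarrow> card (L v) = 3"
    using C by (auto simp: fold_cover_def full_fold_cover_def)
  have H: "multigraph H" using cov by (rule cover_multigraph)
  have fin: "finite (verts G)" "finite (edges G)" using G by (auto simp: multigraph_def)
  have "\<exists>\<phi>. bij_betw \<phi> (UNIV :: 3 set) (L v)" if "v \<in> verts G" for v
    using cL[OF that] by (intro finite_same_card_bij) (auto intro: card_ge_0_finite)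
  then obtain \<phi> :: "'v \<Rightarrow> 3 \<Rightarrow> 'v \<times> 'c"
    where \<phi>: "\<And>v. v \<in> verts G \<Longrightarrow> bij_betw (\<phi> v) UNIV (L v)" by metis
  have \<phi>L: "\<phi> v a \<in> L v" if "v \<in> verts G" for v a using \<phi>[OF that] by (auto simp: bij_betw_def)
  have "\<exists>u v. ends G e = {u, v}" if "e \<in> edges G" for e
    using multigraph_endsE[OF G that] by metis
  \<comment> \<open>An arbitrary orientation of each edge, needed to write its matching as a
    function from labels at \<open>s e\<close> to labels at \<open>t e\<close>.\<close>
  then obtain s t where st: "\<And>e. e \<in> edges G \<Longrightarrow> ends G e = {s e, t e}" by metis
  have "\<exists>p q. \<forall>a b. (\<exists>f\<in>M e. ends H f = {\<phi> (s e) a, \<phi> (t e) b}) \<longleftrightarrow> b = p * a + q"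
    if "e \<in> edges G" for e
    using matching_affine[OF G C that st[OF that] \<phi>] by blast
  then obtain p q where pq: "\<And>e a b. e \<in> edges G \<Longrightarrow>
      (\<exists>f\<in>M e. ends H f = {\<phi> (s e) a, \<phi> (t e) b}) \<longleftrightarrow> b = p e * a + q e"
    by metis
  \<comment> \<open>The factor of \<open>e\<close> vanishes exactly when \<open>M e\<close> joins
    the labels chosen at the two ends of \<open>e\<close>.\<close>
  define F where "F x = (\<Prod>e\<in>edges G. x (t e) - p e * x (s e) - q e)" for x
  define I where "I x = (\<lambda>v. \<phi> v (x v)) ` verts G" for x
  have deg: "deg_less (Suc (card (edges G))) F"
    unfolding F_def[abs_def]
    by (rule deg_less_prod_affine[OF fin(2), where c = "\<lambda>e h. h (t e) - p e * h (s e)"])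
      (simp add: algebra_simps)
  have F0: "F x \<noteq> 0 \<longleftrightarrow> (\<forall>e\<in>edges G. x (t e) \<noteq> p e * x (s e) + q e)" for x
    using fin by (simp add: F_def prod_eq_0_3 algebra_simps)
  have F_iff: "F x \<noteq> 0 \<longleftrightarrow> (\<forall>f\<in>edges H. \<not> ends H f \<subseteq> I x)" for x
  proof
    assume F: "F x \<noteq> 0"
    show "\<forall>f\<in>edges H. \<not> ends H f \<subseteq> I x"
    proof (intro ballI notI)
      fix f assume f: "f \<in> edges H" "ends H f \<subseteq> I x"
      obtain y z where "y \<noteq> z" "ends H f = {y, z}" using multigraph_endsE[OF H f(1)] by metis
      then obtain u v where uv: "u \<in> verts G" "v \<in> verts G" "u \<noteq> v"
        "ends H f = {\<phi> u (x u), \<phi> v (x v)}"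
        using f(2) by (auto simp: I_def)
      obtain e where e: "e \<in> edges G" "ends G e = {u, v}" "f \<in> M e"
        using cover_edge_in_matching[OF cov uv(1-3) \<phi>L[OF uv(1)] \<phi>L[OF uv(2)] f(1) uv(4)] .
      have "{u, v} = {s e, t e}" using st e by simp
      then have "ends H f = {\<phi> (s e) (x (s e)), \<phi> (t e) (x (t e))}"
        using uv(4) by (auto simp: doubleton_eq_iff)
      then show False using pq[OF e(1)] e F F0 by blast
    qed
  next
    assume ind: "\<forall>f\<in>edges H. \<not> ends H f \<subseteq> I x"
    show "F x \<noteq> 0"
      unfolding F0
    proof (intro ballI notI)
      fix e assume e: "e \<in> edges G" "x (t e) = p e * x (s e) + q e"
      then obtain f where f: "f \<in> M e" "ends H f = {\<phi> (s e) (x (s e)), \<phi> (t e) (x (t e))}"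
        using pq by blast
      have "s e \<in> verts G" "t e \<in> verts G"
        using st[OF e(1)] multigraph_endsE[OF G e(1)] by (metis insert_iff singletonD)+
      moreover have "f \<in> edges H" using f cover_matching[OF cov e(1)] unfolding matching_def by blast
      ultimately show False using ind f by (auto simp: I_def)
    qed
  qed
  have "I ` nonzeros (verts G) F \<subseteq> colorings G H"
    using transversal_in_colorings[OF cov, of "\<lambda>v. \<phi> v (x v)" for x] \<phi>L F_iff
    by (auto simp: I_def nonzeros_def)
  moreover have "inj_on I (nonzeros (verts G) F)"
  proof (rule inj_onI, rule ext)
    fix x y v assume xy: "x \<in> nonzeros (verts G) F" "y \<in> nonzeros (verts G) F" "I x = I y"
    show "x v = y v"
    proof (cases "v \<in> verts G")
      case True
      then have "\<phi> v (x v) \<in> I y" using xy(3) by (auto simp: I_def)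
      then obtain w where w: "w \<in> verts G" "\<phi> v (x v) = \<phi> w (y w)" by (auto simp: I_def)
      then have "w = v" using cover_fst[OF cov] \<phi>L True by metis
      then show ?thesis using w \<phi>[OF True] by (auto simp: bij_betw_def inj_on_def)
    qed (use xy in \<open>simp add: nonzeros_def supp_def\<close>)
  qed
  moreover have "finite (colorings G H)"
    by (rule finite_subset[of _ "Pow (verts H)"])
      (use H in \<open>auto simp: colorings_def independent_set_def multigraph_def\<close>)
  ultimately have le: "card (nonzeros (verts G) F) \<le> card (colorings G H)"
    using card_inj_on_le by blast
  obtain J where J: "J \<in> colorings G H" using ne by blast
  then obtain c where c: "\<And>v. v \<in> verts G \<Longrightarrow> c v \<in> L v" "J = c ` verts G"
    using colorings_transversal[OF G cov] by metis
  \<comment> \<open>The value 0 outside \<open>verts G\<close> places \<open>x\<close> in the grid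
    \<open>supp (verts G)\<close>.\<close>
  define x where "x v = (if v \<in> verts G then inv (\<phi> v) (c v) else 0)" for v
  have "\<phi> v (x v) = c v" if "v \<in> verts G" for v
    using \<phi>[OF that] c(1)[OF that] that by (simp add: x_def bij_betw_def f_inv_into_f)
  then have "I x = J" by (simp add: I_def c(2))
  then have "x \<in> nonzeros (verts G) F"
    using J F_iff by (simp add: nonzeros_def supp_def x_def colorings_def independent_set_def)
  then have "9 ^ card (verts G) \<le> 3 ^ card (edges G) * (card (nonzeros (verts G) F))\<^sup>2"
    using alon_furedi_3[OF fin(1) deg] by blast
  also have "\<dots> \<le> 3 ^ card (edges G) * (card (colorings G H))\<^sup>2"
    using le by (intro mult_left_mono power_mono) auto
  finally show ?thesis .
qed

theorem theorem1p6:
  fixes G :: "('v, 'e) multigraph" and n l :: nat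
  assumes "multigraph G"
    and "dp_chromatic_number G \<le> 3"
    and "card (verts G) = n"
    and "card (edges G) = l"
    and "2 * n \<ge> l"
  shows "real (dp_color_function G 3) \<ge> 3 powr (real n - real l / 2)"
proof -
  let ?N = "dp_color_function G 3"
  have "\<exists>N (L :: 'v \<Rightarrow> ('v \<times> nat) set) (H :: ('v \<times> nat, nat) multigraph) M.
      full_fold_cover 3 G L H M \<and> card (colorings G H) = N"
    using full_fold_cover_exists[OF assms(1), of 3] by simp
  \<comment> \<open>The minimum is attained, so it suffices to count the colorings of one full
    cover.\<close>
  from LeastI_ex[OF this] obtain L :: "'v \<Rightarrow> ('v \<times> nat) set"
    and H :: "('v \<times> nat, nat) multigraph" and M
    where C: "full_fold_cover 3 G L H M" and N: "card (colorings G H) = ?N"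
    unfolding dp_color_function_def by blast
  have "fold_cover 3 G L H M" using C by (simp add: full_fold_cover_def)
  then have "colorings G H \<noteq> {}" by (rule fold_cover_colorable[OF assms(1,2)])
  from card_colorings_full_3[OF assms(1) C this]
  have "9 ^ n \<le> 3 ^ l * ?N\<^sup>2" by (simp add: N assms)
  then have "real (9 ^ n) \<le> real (3 ^ l * ?N\<^sup>2)" by (rule of_nat_mono)
  then have "9 ^ n / 3 ^ l \<le> (real ?N)\<^sup>2" by (simp add: field_simps)
  \<comment> \<open>The integer inequality is the square of the claim; both sides are nonnegative,
    so the square can be removed.\<close>
  moreover have "(3 powr (real n - real l / 2))\<^sup>2 = 3 powr (2 * real n - real l)"
    by (simp add: power2_eq_square flip: powr_add)
  moreover have "3 powr (2 * real n - real l) = 9 ^ n / 3 ^ l"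
    using powr_realpow[of 3 "2 * n"] by (simp add: powr_diff powr_realpow power_mult)
  ultimately have "(3 powr (real n - real l / 2))\<^sup>2 \<le> (real ?N)\<^sup>2" by simp
  then show ?thesis by (rule power2_le_imp_le) simp
qed

end
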